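(* Let $f:\mathbb{N}\to\mathbb{C}$ be a multiplicative function. If there exists an integer $k$ with $|k|\ge 2$ such that $f^{k\circ}(n)=k^{\Omega(n)}f(n)$ for all $n\ge1$, then $f$ is completely multiplicative.
   Context: A function $f$ is multiplicative if $f(1)=1$ and $f(mn)=f(m)f(n)$ whenever $\gcd(m,n)=1$; completely multiplicative if $f(1)=1$ and $f(mn)=f(m)f(n)$ for all $m,n$. For $n\in\mathbb{N}$ write $n=\prod_p p^{\nu_p(n)}$ and $\Omega(n)=\sum_p\nu_p(n)$. The binomial convolution is $(f\circ g)(n)=\sum_{d\mid n}\left(\prod_p\binom{\nu_p(n)}{\nu_p(d)}\right)f(d)g(n/d)$, with identity $\delta$ ($\delta(1)=1$, $\delta(n)=0$ for $n>1$). For $k>0$, $f^{k\circ}=f\circ\cdots\circ f$ ($k$ factors) and $f^{-k\circ}=f^{-1\circ}\circ\cdots\circ f^{-1\circ}$ ($k$ factors), where $f^{-1\circ}$ is the inverse of $f$ under $\circ$ (which exists for multiplicative $f$ since $f(1)=1$). *)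

theory Defs
  imports Complex_Main "HOL-Computational_Algebra.Primes"
begin

text \<open>
  An arithmetical function on the positive integers is represented by a function of type
  \<open>nat \<Rightarrow> complex\<close>; its value at \<open>0\<close> carries no meaning, and every
  condition below is restricted to positive arguments.
\<close>

definition multiplicative_fun :: "(nat \<Rightarrow> complex) \<Rightarrow> bool" where
  "multiplicative_fun f \<longleftrightarrow>
     f 1 = 1 \<and> (\<forall>m\<ge>1. \<forall>n\<ge>1. coprime m n \<longrightarrow> f (m * n) = f m * f n)"

definition completely_multiplicative_fun :: "(nat \<Rightarrow> complex) \<Rightarrow> bool" where
  "completely_multiplicative_fun f \<longleftrightarrow>
     f 1 = 1 \<and> (\<forall>m\<ge>1. \<forall>n\<ge>1. f (m * n) = f m * f n)"

definition Omega :: "nat \<Rightarrow> nat" where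
  "Omega n = (\<Sum>p\<in>prime_factors n. multiplicity p n)"

text \<open>
  For \<open>d dvd n\<close>, primes outside \<open>prime_factors n\<close> would contribute the factor
  \<open>0 choose 0 = 1\<close>, so the product over all primes is the finite product below.
\<close>

definition binom_coeff :: "nat \<Rightarrow> nat \<Rightarrow> nat" where
  "binom_coeff n d = (\<Prod>p\<in>prime_factors n. multiplicity p n choose multiplicity p d)"

definition binom_conv :: "(nat \<Rightarrow> complex) \<Rightarrow> (nat \<Rightarrow> complex) \<Rightarrow> nat \<Rightarrow> complex" where
  "binom_conv f g n = (\<Sum>d | d dvd n. of_nat (binom_coeff n d) * f d * g (n div d))"

definition delta :: "nat \<Rightarrow> complex" where
  "delta n = (if n = 1 then 1 else 0)"

text \<open>
  The condition \<open>g 0 = 0\<close> only pins down the meaningless value at \<open>0\<close>, so that the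
  inverse is unique as a function on \<open>nat\<close>; see \<open>binom_inverse_ex1\<close>.
\<close>

definition binom_inverse :: "(nat \<Rightarrow> complex) \<Rightarrow> nat \<Rightarrow> complex" where
  "binom_inverse f = (THE g. g 0 = 0 \<and> (\<forall>n\<ge>1. binom_conv f g n = delta n))"

primrec binom_npow :: "(nat \<Rightarrow> complex) \<Rightarrow> nat \<Rightarrow> nat \<Rightarrow> complex" where
  "binom_npow f 0 = delta"
| "binom_npow f (Suc k) = binom_conv f (binom_npow f k)"

definition binom_pow :: "(nat \<Rightarrow> complex) \<Rightarrow> int \<Rightarrow> nat \<Rightarrow> complex" where
  "binom_pow f k = (if k \<ge> 0 then binom_npow f (nat k)
                    else binom_npow (binom_inverse f) (nat (- k)))"

lemma binom_coeff_1 [simp]: "binom_coeff n 1 = 1"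
  by (simp add: binom_coeff_def)

lemma binom_conv_split:
  assumes "n \<ge> 1"
  shows "binom_conv f g n =
    f 1 * g n + (\<Sum>d | d dvd n \<and> d \<noteq> 1. of_nat (binom_coeff n d) * f d * g (n div d))"
proof -
  have eq: "{d. d dvd n} = insert 1 {d. d dvd n \<and> d \<noteq> 1}"
    by auto
  have fin: "finite {d. d dvd n \<and> d \<noteq> 1}"
    using assms by (intro finite_subset[OF _ finite_divisors_nat[of n]]) auto
  show ?thesis
    unfolding binom_conv_def eq using fin by (subst sum.insert) (auto simp: binom_coeff_def)
qed

fun binom_inv_rec :: "(nat \<Rightarrow> complex) \<Rightarrow> nat \<Rightarrow> complex" where
  "binom_inv_rec f n = (if n = 0 then 0 else
     (delta n - (\<Sum>d | d dvd n \<and> d \<noteq> 1. of_nat (binom_coeff n d) * f d *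
        (if n div d < n then binom_inv_rec f (n div d) else 0))) / f 1)"

declare binom_inv_rec.simps [simp del]

lemma div_less_of_proper:
  fixes n d :: nat
  assumes "n \<ge> 1" "d dvd n" "d \<noteq> 1"
  shows "n div d < n" "n div d \<ge> 1"
proof -
  have "d > 0" using assms by (auto intro: Nat.gr0I)
  with assms show "n div d < n" by (intro div_less_dividend) auto
  show "n div d \<ge> 1" using assms \<open>d > 0\<close>
    by (auto elim!: dvdE)
qed

lemma binom_inverse_ex1:
  assumes "f 1 \<noteq> 0"
  shows "\<exists>!g. g 0 = 0 \<and> (\<forall>n\<ge>1. binom_conv f g n = delta n)"
proof (rule ex_ex1I)
  have "binom_conv f (binom_inv_rec f) n = delta n" if n: "n \<ge> 1" for n
  proof -
    have "(\<Sum>d | d dvd n \<and> d \<noteq> 1. of_nat (binom_coeff n d) * f d *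
        (if n div d < n then binom_inv_rec f (n div d) else 0)) =
      (\<Sum>d | d dvd n \<and> d \<noteq> 1. of_nat (binom_coeff n d) * f d * binom_inv_rec f (n div d))"
      using div_less_of_proper(1)[OF n] by (intro sum.cong) auto
    then show ?thesis
      using n assms unfolding binom_conv_split[OF n]
      by (subst (1) binom_inv_rec.simps) simp
  qed
  moreover have "binom_inv_rec f 0 = 0"
    by (simp add: binom_inv_rec.simps)
  ultimately show "\<exists>g. g 0 = 0 \<and> (\<forall>n\<ge>1. binom_conv f g n = delta n)"
    by blast
next
  fix g h
  assume g: "g 0 = 0 \<and> (\<forall>n\<ge>1. binom_conv f g n = delta n)"
    and h: "h 0 = 0 \<and> (\<forall>n\<ge>1. binom_conv f h n = delta n)"
  have "g n = h n" for n
  proof (induction n rule: less_induct)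
    case (less n)
    show ?case
    proof (cases "n = 0")
      case True
      with g h show ?thesis by simp
    next
      case False
      then have n: "n \<ge> 1" by simp
      have "(\<Sum>d | d dvd n \<and> d \<noteq> 1. of_nat (binom_coeff n d) * f d * g (n div d)) =
            (\<Sum>d | d dvd n \<and> d \<noteq> 1. of_nat (binom_coeff n d) * f d * h (n div d))"
        using div_less_of_proper(1)[OF n] less.IH by (intro sum.cong) auto
      moreover have "binom_conv f g n = binom_conv f h n"
        using g h n by simp
      ultimately show ?thesis
        using assms unfolding binom_conv_split[OF n] by simp
    qed
  qed
  then show "g = h" by blast
qed

lemma binom_conv_binom_inverse:
  assumes "f 1 \<noteq> 0" "n \<ge> 1"
  shows "binom_conv f (binom_inverse f) n = delta n"
  using theI'[OF binom_inverse_ex1[of f, OF assms(1)]] assms(2)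
  unfolding binom_inverse_def by blast

end

theory Submission
  imports Defs "HOL-Computational_Algebra.Formal_Power_Series"
begin

text \<open>
  On the powers of a prime \<open>p\<close> the binomial convolution is the product of the exponential
  generating functions \<open>F(x) = \<Sum>\<^sub>n f(p\<^sup>n) x\<^sup>n / n!\<close>, so the hypothesis says \<open>F(x)\<^sup>k = F(k x)\<close>.
  Taking logarithmic derivatives, \<open>G = F'/F\<close> satisfies \<open>G(x) = G(k x)\<close>; as \<open>k\<close> is not a root of
  unity, \<open>G\<close> is constant, so \<open>F(x) = exp(f(p) x)\<close> and \<open>f(p\<^sup>n) = f(p)\<^sup>n\<close>.
\<close>

unbundle fps_syntax

text \<open>The hypothesis \<open>ode\<close> is P'/P = c F'/F cleared of denominators:
  \<open>P\<close> behaves like the \<open>c\<close>-th power of \<open>F\<close>, but no power is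
  mentioned, so positive and negative exponents are covered at once.\<close>

lemma fps_eq_exp_of_scaling:
  fixes F P :: "'a::field_char_0 fps"
  assumes F0: "F $ 0 = 1"
    and c: "c \<noteq> 0" "\<And>n. n > 0 \<Longrightarrow> c ^ n \<noteq> 1"
    and ode: "fps_deriv P * F = fps_const c * fps_deriv F * P"
    and P: "\<And>n. P $ n = c ^ n * F $ n"
  shows "F = fps_exp (F $ 1)"
proof -
  \<comment> \<open>Composing with \<open>L\<close> substitutes c x for x, which multiplies the n-th
    coefficient by \<open>c ^ n\<close>.\<close>
  define L where "L = fps_const c * fps_X"
  define G where "G = fps_deriv F * inverse F"
  have P_eq: "P = F oo L"
    by (simp add: fps_eq_iff P L_def fps_compose_linear)
  have F_nz: "F \<noteq> 0" "F oo L \<noteq> 0"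
    using F0 by (auto simp: fps_eq_iff L_def fps_compose_linear intro!: exI[of _ 0])
  have deriv_F: "fps_deriv F = G * F"
    using F0 inverse_mult_eq_1[of F] by (simp add: G_def mult.assoc)
  have "fps_deriv (F oo L) = fps_const c * ((G oo L) * (F oo L))"
    by (simp add: fps_compose_deriv deriv_F fps_compose_mult_distrib L_def mult.commute)
  \<comment> \<open>Both logarithmic derivatives now carry the same nonzero factor, which cancels in
    the integral domain of power series.\<close>
  with ode have "fps_const c * (F * (F oo L)) * (G oo L) = fps_const c * (F * (F oo L)) * G"
    by (simp add: P_eq deriv_F ac_simps)
  with F_nz c have "G oo L = G"
    by simp
  then have "c ^ n * G $ n = G $ n" for n
    by (metis L_def fps_compose_linear fps_nth_Abs_fps)
  then have "G $ n = 0" if "n > 0" for n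
    using c(2)[OF that] by (metis mult_cancel_right1)
  then have "G = fps_const (G $ 0)"
    by (auto simp: fps_eq_iff)
  moreover have "G $ 0 = F $ 1"
    using F0 by (simp add: G_def)
  ultimately have "fps_deriv F = fps_const (F $ 1) * F"
    using deriv_F by simp
  then have "F = fps_const (F $ 0) * fps_exp (F $ 1)"
    by (simp only: fps_exp_unique_ODE)
  then show ?thesis
    by (simp add: F0)
qed

definition prime_egf :: "nat \<Rightarrow> (nat \<Rightarrow> complex) \<Rightarrow> complex fps" where
  "prime_egf p f = Abs_fps (\<lambda>n. f (p ^ n) / fact n)"

lemma prime_egf_nth [simp]: "prime_egf p f $ n = f (p ^ n) / fact n"
  by (simp add: prime_egf_def)

lemma binom_coeff_prime_power:
  assumes "prime p" "i \<le> n"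
  shows "binom_coeff (p ^ n) (p ^ i) = n choose i"
proof (cases "n = 0")
  case False
  with assms show ?thesis
    by (simp add: binom_coeff_def prime_factorization_prime_power)
qed (use assms in \<open>simp add: binom_coeff_def\<close>)

lemma Omega_prime_power:
  assumes "prime p"
  shows "Omega (p ^ n) = n"
proof (cases "n = 0")
  case False
  with assms show ?thesis
    by (simp add: Omega_def prime_factorization_prime_power)
qed (simp add: Omega_def)

lemma binom_conv_prime_power:
  assumes p: "prime p"
  shows "binom_conv f g (p ^ n) = (\<Sum>i\<le>n. of_nat (n choose i) * f (p ^ i) * g (p ^ (n - i)))"
proof -
  have div: "{d. d dvd p ^ n} = (\<lambda>i. p ^ i) ` {..n}"
    using divides_primepow_nat[OF p] by auto
  have inj: "inj_on (\<lambda>i. p ^ i) {..n}"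
    using prime_gt_1_nat[OF p] by (auto simp: inj_on_def)
  show ?thesis
    unfolding binom_conv_def div sum.reindex[OF inj] o_def using p
    by (intro sum.cong)
       (auto simp: binom_coeff_prime_power power_diff dest: prime_gt_0_nat)
qed

text \<open>Since (n choose i) / n! = 1 / (i! (n - i)!), dividing the binomial sum by n! turns it
  into a Cauchy product.\<close>

lemma prime_egf_binom_conv:
  assumes "prime p"
  shows "prime_egf p (binom_conv f g) = prime_egf p f * prime_egf p g"
  by (auto simp: fps_eq_iff binom_conv_prime_power[OF assms] fps_mult_nth atLeast0AtMost
      sum_divide_distrib binomial_fact intro!: sum.cong)

lemma prime_egf_delta:
  assumes "prime p"
  shows "prime_egf p delta = 1"
  using prime_gt_1_nat[OF assms] by (auto simp: fps_eq_iff delta_def)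

lemma prime_egf_binom_npow:
  assumes "prime p"
  shows "prime_egf p (binom_npow f k) = prime_egf p f ^ k"
  by (induction k) (simp_all add: assms prime_egf_delta prime_egf_binom_conv)

lemma prime_egf_binom_inverse:
  assumes p: "prime p" and "f 1 \<noteq> 0"
  shows "prime_egf p f * prime_egf p (binom_inverse f) = 1"
proof -
  \<comment> \<open>The series sample their functions only at prime powers, which are positive, so
    the inverse law for arguments at least 1 suffices.\<close>
  have "prime_egf p (binom_conv f (binom_inverse f)) = prime_egf p delta"
    using binom_conv_binom_inverse[of f, OF assms(2)] prime_gt_0_nat[OF p]
    by (simp add: fps_eq_iff Suc_le_eq)
  then show ?thesis
    by (simp add: prime_egf_binom_conv prime_egf_delta p)
qed

text \<open>This is the power rule multiplied by \<open>F\<close>, which avoids the exponent m - 1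
  and so includes m = 0.\<close>

lemma fps_deriv_power_mult_self:
  fixes F :: "'a::comm_ring_1 fps"
  shows "fps_deriv (F ^ m) * F = of_nat m * fps_deriv F * F ^ m"
  by (induction m) (simp_all add: algebra_simps)

text \<open>The series of the \<open>k\<close>-th power is F^k, or H^(-k) with H = 1/F when
  \<open>k\<close> is negative; in both cases its logarithmic derivative is k F'/F.\<close>

lemma prime_egf_binom_pow_ode:
  fixes f :: "nat \<Rightarrow> complex"
  assumes p: "prime p" and f1: "f 1 \<noteq> 0"
  shows "fps_deriv (prime_egf p (binom_pow f k)) * prime_egf p f =
    fps_const (of_int k) * fps_deriv (prime_egf p f) * prime_egf p (binom_pow f k)"
proof (cases "k \<ge> 0")
  case True
  then obtain m where "k = int m"
    using nonneg_int_cases by blast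
  then show ?thesis
    by (simp add: binom_pow_def prime_egf_binom_npow p fps_deriv_power_mult_self fps_of_nat)
next
  case False
  define m where "m = nat (- k)"
  have k: "k = - int m"
    using False by (simp add: m_def)
  define F where "F = prime_egf p f"
  define H where "H = prime_egf p (binom_inverse f)"
  have FH: "F * H = 1"
    unfolding F_def H_def using p f1 by (rule prime_egf_binom_inverse)
  then have "fps_deriv (F * H) = 0"
    by simp
  then have dH: "F * fps_deriv H = - (fps_deriv F * H)"
    by (simp add: add_eq_0_iff2 ac_simps)
  \<comment> \<open>Inserting F H = 1 supplies the factor \<open>H\<close> that the power rule for
    \<open>H ^ m\<close> requires.\<close>
  have "fps_deriv (H ^ m) * F = fps_deriv (H ^ m) * H * (F * F)"
    using FH by (simp add: algebra_simps)
  also have "\<dots> = of_nat m * (F * fps_deriv H) * H ^ m * F"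
    by (simp only: fps_deriv_power_mult_self) (simp add: ac_simps)
  also have "\<dots> = - of_nat m * fps_deriv F * H ^ m * (F * H)"
    by (simp add: dH algebra_simps)
  finally have "fps_deriv (H ^ m) * F = fps_const (of_int k) * fps_deriv F * H ^ m"
    by (simp add: FH k fps_of_nat flip: fps_const_neg)
  with False show ?thesis
    by (simp add: binom_pow_def prime_egf_binom_npow p F_def H_def m_def)
qed

text \<open>By induction on the prime factors of the first argument, it is enough to pull out one
  prime at a time.\<close>

lemma completely_multiplicative_of_prime_powers:
  assumes f: "multiplicative_fun f"
    and pow: "\<And>p n. prime p \<Longrightarrow> f (p ^ n) = f p ^ n"
  shows "completely_multiplicative_fun f"
proof -
  have f1: "f 1 = 1" and cop: "\<And>m n. m \<ge> 1 \<Longrightarrow> n \<ge> 1 \<Longrightarrow> coprime m n \<Longrightarrow> f (m * n) = f m * f n"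
    using f by (auto simp: multiplicative_fun_def)
  have prime_step: "f (p * n) = f p * f n" if p: "prime p" and n: "n \<ge> 1" for p n
  proof -
    \<comment> \<open>Splitting off the full power of \<open>p\<close> leaves a cofactor coprime to
      every power of \<open>p\<close>, so multiplicativity applies before and after the exponent is
      raised by one.\<close>
    obtain m where m: "n = p ^ multiplicity p n * m" "\<not> p dvd m"
      using multiplicity_decompose'[of n p] n p by (metis not_one_le_zero not_prime_unit)
    let ?a = "multiplicity p n"
    have "m \<ge> 1" "p ^ j \<ge> 1" for j
      using m n prime_gt_0_nat[OF p] by (auto simp: Suc_le_eq intro: Nat.gr0I)
    moreover have "coprime (p ^ j) m" for j
      using prime_imp_coprime[OF p m(2)] by simp
    ultimately have split: "f (p ^ j * m) = f p ^ j * f m" for j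
      using cop pow[OF p] by simp
    have "f (p * n) = f (p ^ Suc ?a * m)"
      by (subst m(1)) (simp add: mult.assoc)
    also have "\<dots> = f p * f (p ^ ?a * m)"
      by (simp only: split) simp
    finally show ?thesis
      using m(1) by simp
  qed
  have "f (m * n) = f m * f n" if "m \<ge> 1" "n \<ge> 1" for m n
    using that(1)
  proof (induction m rule: prime_divisors_induct)
    case (factor p m)
    then have "m \<ge> 1"
      by (auto intro: Nat.gr0I simp: Suc_le_eq)
    with factor prime_step[of p m] prime_step[of p "m * n"] that(2) show ?case
      by (simp add: mult.assoc)
  qed (use f1 in auto)
  with f1 show ?thesis
    by (simp add: completely_multiplicative_fun_def)
qed

theorem theorem3p2:
  fixes f :: "nat \<Rightarrow> complex"
  assumes "multiplicative_fun f"
    and "\<exists>k::int. \<bar>k\<bar> \<ge> 2 \<and>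
           (\<forall>n\<ge>1. binom_pow f k n = of_int k ^ Omega n * f n)"
  shows "completely_multiplicative_fun f"
proof (rule completely_multiplicative_of_prime_powers[OF assms(1)])
  fix p n :: nat
  assume p: "prime p"
  obtain k :: int where k: "\<bar>k\<bar> \<ge> 2"
    and pow: "\<And>n. n \<ge> 1 \<Longrightarrow> binom_pow f k n = of_int k ^ Omega n * f n"
    using assms(2) by blast
  have f1: "f 1 = 1"
    using assms(1) by (simp add: multiplicative_fun_def)
  let ?F = "prime_egf p f"
  \<comment> \<open>This is where |k| \<ge> 2 enters: an integer that is a root of unity has
    absolute value 1.\<close>
  have "of_int k ^ n \<noteq> (1::complex)" if "n > 0" for n
  proof
    assume "of_int k ^ n = (1::complex)"
    then have "k ^ n = 1"
      by (metis of_int_eq_1_iff of_int_power)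
    then have "\<bar>k\<bar> ^ n = 1"
      by (metis abs_one power_abs)
    with one_less_power[of "\<bar>k\<bar>" n] k that show False
      by simp
  qed
  moreover have "prime_egf p (binom_pow f k) $ j = of_int k ^ j * ?F $ j" for j
    using pow[of "p ^ j"] prime_gt_0_nat[OF p] by (simp add: Omega_prime_power p Suc_le_eq)
  ultimately have "?F = fps_exp (?F $ 1)"
    using k f1 prime_egf_binom_pow_ode[of p f k] p
    by (intro fps_eq_exp_of_scaling[of _ "of_int k" "prime_egf p (binom_pow f k)"]) auto
  \<comment> \<open>The n-th coefficients are f(p^n) / n! and f(p)^n / n!.\<close>
  then have "?F $ n = fps_exp (?F $ 1) $ n"
    by (rule arg_cong)
  then show "f (p ^ n) = f p ^ n"
    by simp
qed

end
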